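(* Let $p>3$ be a prime. Let $\mathbb{X}_{-2}(\mathbb{F}_p)=\{(x,y,z)\in\mathbb{F}_p^3 : x^2+y^2+z^2=xyz\}$, let $\mathbb{X}^*_{-2}(\mathbb{F}_p)=\mathbb{X}_{-2}(\mathbb{F}_p)\setminus\{(0,0,0)\}$, and let $\mathbb{Y}_{-2}(\mathbb{F}_p)$ be the set of orbits in $\mathbb{X}^*_{-2}(\mathbb{F}_p)$ of the Klein four-group $N=\{\mathrm{id},n_1,n_2,n_3\}$, where $n_1(x,y,z)=(x,-y,-z)$, $n_2(x,y,z)=(-x,y,-z)$, $n_3(x,y,z)=(-x,-y,z)$. Let $n=|\mathbb{Y}_{-2}(\mathbb{F}_p)|$ and let $H(p)$ be the permutation group of $\mathbb{Y}_{-2}(\mathbb{F}_p)$ induced by the action of $\mathrm{Out}(\mathbf{F}_2)$. Then $H(p)\le A_n$ (i.e. every element of $H(p)$ is an even permutation of $\mathbb{Y}_{-2}(\mathbb{F}_p)$) if and only if $p\equiv 3\pmod{16}$.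
   Context: $\mathbf{F}_2$ is the free group on two generators; $\mathrm{Out}(\mathbf{F}_2)\cong\mathrm{GL}_2(\mathbf{Z})$ acts on $\mathbb{X}_{-2}$ by polynomial automorphisms (via Fricke trace coordinates $x=\mathrm{tr}A$, $y=\mathrm{tr}B$, $z=\mathrm{tr}AB$), through $\mathrm{PGL}_2(\mathbf{Z})$, and this action commutes with $N$, so it permutes the $N$-orbits. Concretely, the image of $\mathrm{Out}(\mathbf{F}_2)$ acting on $\mathbb{X}_{-2}(\mathbb{F}_p)$ is generated by the Markoff moves $m_1(x,y,z)=(yz-x,y,z)$, $m_2(x,y,z)=(x,xz-y,z)$, $m_3(x,y,z)=(x,y,xy-z)$ together with the six permutations of the coordinates; so $H(p)$ is the group of permutations of $\mathbb{Y}_{-2}(\mathbb{F}_p)$ generated by the permutations induced by $m_1,m_2,m_3$ and the coordinate permutations. $A_n$ denotes the alternating group on the $n$ elements of $\mathbb{Y}_{-2}(\mathbb{F}_p)$. *)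

theory Defs
  imports
    "Berlekamp_Zassenhaus.Finite_Field"
    "HOL-Algebra.Generated_Groups"
    "HOL-Combinatorics.Permutations"
begin

type_synonym 'a point = "'a \<times> 'a \<times> 'a"

definition X_set :: "'a::comm_ring_1 point set" where
  "X_set = {(x, y, z). x\<^sup>2 + y\<^sup>2 + z\<^sup>2 = x * y * z}"

definition X_star :: "'a::comm_ring_1 point set" where
  "X_star = X_set - {(0, 0, 0)}"

definition n1 :: "'a::comm_ring_1 point \<Rightarrow> 'a point" where
  "n1 = (\<lambda>(x, y, z). (x, - y, - z))"

definition n2 :: "'a::comm_ring_1 point \<Rightarrow> 'a point" where
  "n2 = (\<lambda>(x, y, z). (- x, y, - z))"

definition n3 :: "'a::comm_ring_1 point \<Rightarrow> 'a point" where
  "n3 = (\<lambda>(x, y, z). (- x, - y, z))"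

definition N_group :: "('a::comm_ring_1 point \<Rightarrow> 'a point) set" where
  "N_group = {id, n1, n2, n3}"

definition N_orbit :: "'a::comm_ring_1 point \<Rightarrow> 'a point set" where
  "N_orbit v = {g v |g. g \<in> N_group}"

definition Y_set :: "'a::comm_ring_1 point set set" where
  "Y_set = N_orbit ` X_star"

definition m1 :: "'a::comm_ring_1 point \<Rightarrow> 'a point" where
  "m1 = (\<lambda>(x, y, z). (y * z - x, y, z))"

definition m2 :: "'a::comm_ring_1 point \<Rightarrow> 'a point" where
  "m2 = (\<lambda>(x, y, z). (x, x * z - y, z))"

definition m3 :: "'a::comm_ring_1 point \<Rightarrow> 'a point" where
  "m3 = (\<lambda>(x, y, z). (x, y, x * y - z))"

definition coordinate_perms :: "('a point \<Rightarrow> 'a point) set" where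
  "coordinate_perms =
     {\<lambda>(x, y, z). (x, y, z), \<lambda>(x, y, z). (x, z, y), \<lambda>(x, y, z). (y, x, z),
      \<lambda>(x, y, z). (y, z, x), \<lambda>(x, y, z). (z, x, y), \<lambda>(x, y, z). (z, y, x)}"

text \<open>Permutations of a set are functions on the whole type that fix everything outside that set,
  following the library's \<^term>\<open>(permutes)\<close>; hence the second branch.\<close>

definition induced_perm :: "('a::comm_ring_1 point \<Rightarrow> 'a point) \<Rightarrow> 'a point set \<Rightarrow> 'a point set" where
  "induced_perm f B = (if B \<in> Y_set then f ` B else B)"

text \<open>The library's symmetric and alternating groups act on \<open>{1..n}\<close> only; these are the same
  groups on an arbitrary finite set.\<close>

definition Sym_on :: "'b set \<Rightarrow> ('b \<Rightarrow> 'b) monoid" where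
  "Sym_on S = \<lparr>carrier = {\<sigma>. \<sigma> permutes S}, monoid.mult = (\<circ>), one = id\<rparr>"

definition Alt_on :: "'b set \<Rightarrow> ('b \<Rightarrow> 'b) monoid" where
  "Alt_on S = \<lparr>carrier = {\<sigma>. \<sigma> permutes S \<and> evenperm \<sigma>}, monoid.mult = (\<circ>), one = id\<rparr>"

definition H_gens :: "('a::comm_ring_1 point set \<Rightarrow> 'a point set) set" where
  "H_gens = induced_perm ` ({m1, m2, m3} \<union> coordinate_perms)"

text \<open>The image of \<open>Out(F\<^sub>2)\<close>, acting by polynomial automorphisms in the Fricke trace
  coordinates, is generated by the Markoff moves and the coordinate permutations.\<close>

definition H_group :: "('a::comm_ring_1 point set \<Rightarrow> 'a point set) set" where
  "H_group = generate (Sym_on Y_set) H_gens"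

lemma N_orbit_eq: "N_orbit v = {v, n1 v, n2 v, n3 v}"
  unfolding N_orbit_def N_group_def Setcompr_eq_image by simp

lemma group_Sym_on: "group (Sym_on S)"
proof (rule groupI)
  fix \<sigma> assume "\<sigma> \<in> carrier (Sym_on S)"
  then show "\<exists>\<tau>\<in>carrier (Sym_on S). \<tau> \<otimes>\<^bsub>Sym_on S\<^esub> \<sigma> = \<one>\<^bsub>Sym_on S\<^esub>"
    by (auto simp: Sym_on_def permutes_inv_o intro!: bexI[of _ "inv_into UNIV \<sigma>"] permutes_inv)
qed (auto simp: Sym_on_def permutes_id permutes_compose o_assoc)

lemma induced_perm_permutes:
  fixes f g :: "'a::comm_ring_1 point \<Rightarrow> 'a point"
  assumes f: "f ` X_star \<subseteq> X_star" "\<And>v. f ` N_orbit v = N_orbit (f v)"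
    and g: "g ` X_star \<subseteq> X_star" "\<And>v. g ` N_orbit v = N_orbit (g v)"
    and inv: "\<And>v. f (g v) = v" "\<And>v. g (f v) = v"
  shows "induced_perm f permutes Y_set"
proof (rule bij_imp_permutes)
  show "bij_betw (induced_perm f) Y_set Y_set"
  proof (rule bij_betw_byWitness[where f' = "induced_perm g"])
    have fY: "f ` B \<in> Y_set" if "B \<in> Y_set" for B
      using that f by (auto simp: Y_set_def)
    have gY: "g ` B \<in> Y_set" if "B \<in> Y_set" for B
      using that g by (auto simp: Y_set_def)
    show "\<forall>B\<in>Y_set. induced_perm g (induced_perm f B) = B"
      using fY inv by (auto simp: induced_perm_def image_image)
    show "\<forall>B\<in>Y_set. induced_perm f (induced_perm g B) = B"
      using gY inv by (auto simp: induced_perm_def image_image)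
    show "induced_perm f ` Y_set \<subseteq> Y_set" "induced_perm g ` Y_set \<subseteq> Y_set"
      using fY gY by (auto simp: induced_perm_def)
  qed
qed (simp add: induced_perm_def)

lemma induced_m_permutes:
  fixes Y :: "'a::comm_ring_1 point set set"
  defines "Y \<equiv> Y_set"
  shows "induced_perm m1 permutes Y" "induced_perm m2 permutes Y" "induced_perm m3 permutes Y"
proof -
  note d = N_orbit_eq n1_def n2_def n3_def m1_def m2_def m3_def
  have X: "m1 ` X_star \<subseteq> (X_star :: 'a point set)" "m2 ` X_star \<subseteq> (X_star :: 'a point set)"
    "m3 ` X_star \<subseteq> (X_star :: 'a point set)"
    by (auto simp: X_star_def X_set_def m1_def m2_def m3_def power2_eq_square left_diff_distrib
        right_diff_distrib ac_simps)
  have O: "m1 ` N_orbit v = N_orbit (m1 v)" "m2 ` N_orbit v = N_orbit (m2 v)"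
    "m3 ` N_orbit v = N_orbit (m3 v)" for v :: "'a point"
    by (simp_all add: d split_beta)
  have I: "m1 (m1 v) = v" "m2 (m2 v) = v" "m3 (m3 v) = v" for v :: "'a point"
    by (simp_all add: d split_beta)
  show "induced_perm m1 permutes Y"
    unfolding Y_def by (rule induced_perm_permutes[where g = m1, OF X(1) O(1) X(1) O(1) I(1) I(1)])
  show "induced_perm m2 permutes Y"
    unfolding Y_def by (rule induced_perm_permutes[where g = m2, OF X(2) O(2) X(2) O(2) I(2) I(2)])
  show "induced_perm m3 permutes Y"
    unfolding Y_def by (rule induced_perm_permutes[where g = m3, OF X(3) O(3) X(3) O(3) I(3) I(3)])
qed

lemma induced_coordinate_perm_permutes:
  assumes "f \<in> coordinate_perms"
  shows "induced_perm f permutes Y_set"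
proof -
  have X: "h ` X_star \<subseteq> X_star" if "h \<in> coordinate_perms" for h :: "'a point \<Rightarrow> 'a point"
    using that by (auto simp: X_star_def X_set_def coordinate_perms_def ac_simps)
  have O: "h ` N_orbit v = N_orbit (h v)" if "h \<in> coordinate_perms" for h :: "'a point \<Rightarrow> 'a point" and v
    using that by (cases v) (auto simp: N_orbit_eq n1_def n2_def n3_def coordinate_perms_def)
  have "\<exists>g\<in>coordinate_perms. (\<forall>v. f (g v) = v) \<and> (\<forall>v. g (f v) = v)"
    using assms unfolding coordinate_perms_def by (elim insertE emptyE; hypsubst) simp_all
  then obtain g where "g \<in> coordinate_perms" "\<And>v. f (g v) = v" "\<And>v. g (f v) = v"
    by blast
  then show ?thesis
    using X O assms by (intro induced_perm_permutes[where g = g])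
qed

lemma H_gens_subset: "H_gens \<subseteq> carrier (Sym_on Y_set)"
  using induced_m_permutes induced_coordinate_perm_permutes by (auto simp: H_gens_def Sym_on_def)

lemma H_group_subgroup: "subgroup H_group (Sym_on Y_set)"
  unfolding H_group_def by (rule group.generate_is_subgroup[OF group_Sym_on H_gens_subset])

end

theory Submission
  imports Defs
begin

text \<open>
  Modulo conjugation by coordinate permutations, the generators are \<open>m3\<close> and the swap of \<open>x\<close> and
  \<open>y\<close>, and both are involutions. As \<open>N\<close> acts freely on \<open>X_star\<close>, such an involution is even iff
  \<open>16\<close> divides the number of points of \<open>X_star\<close> whose \<open>N\<close>-orbit it moves.

  Completing the square identifies the points with \<open>xy \<noteq> 0\<close> with the points of the sphere
  \<open>u\<^sup>2 + v\<^sup>2 + w\<^sup>2 = 1\<close> with \<open>uv \<noteq> 0\<close>. Those moved by \<open>m3\<close> are the ones with \<open>uvw \<noteq> 0\<close>; their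
  number is \<open>8\<close> times the number of ways to write \<open>1\<close> as an ordered sum of three nonzero squares
  \<open>a + b + c\<close>. Exchanging \<open>a\<close> and \<open>b\<close> reduces the parity of the latter to the case \<open>a = b\<close>, that is,
  to counting points on the conic \<open>2u\<^sup>2 + w\<^sup>2 = 1\<close>, and \<open>m3\<close> turns out to be even iff \<open>q\<close> is
  \<open>3\<close> modulo \<open>8\<close>, for a field of \<open>q\<close> elements. In that case the swap moves the points with
  \<open>u\<^sup>2 \<noteq> v\<^sup>2\<close>. Those with \<open>w \<noteq> 0\<close> come in groups of \<open>16\<close>, and those with \<open>w = 0\<close> form the conic
  \<open>u\<^sup>2 + v\<^sup>2 = 1\<close> with \<open>uv \<noteq> 0\<close>, which has \<open>q - 3\<close> points.

  The quadratic characters of \<open>-1\<close>, \<open>2\<close> and \<open>-2\<close> are read off from the same conics: the point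
  counts \<open>q - 1 - n_sqrt (-k) - n_sqrt (1/k)\<close> are divisible by \<open>4\<close> because of the sign changes,
  and for \<open>k = 1\<close> exchanging the coordinates shows that divisibility by \<open>8\<close> fails exactly when
  \<open>1/2\<close> is a square.
\<close>

section \<open>Counting by fibres and the parity of involutions\<close>

lemma card_eq_mult_card_if_fibres:
  assumes "finite A" "finite B" "f ` A \<subseteq> B"
    and fibre: "\<And>b. b \<in> B \<Longrightarrow> card {a \<in> A. f a = b} = k"
  shows "card A = k * card B"
proof -
  have "card A = (\<Sum>b\<in>B. \<Sum>a | a \<in> A \<and> f a = b. 1)"
    using sum.group[of A B f "\<lambda>_. 1 :: nat"] assms by simp
  also have "\<dots> = k * card B"
    using fibre by simp
  finally show ?thesis .
qed

text \<open>Induction on the number of moved points: composing with the transposition of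
  \<open>a\<close> and \<open>\<sigma> a\<close> cancels one 2-cycle and flips the sign, so
  \<open>k\<close> counts the 2-cycles.\<close>

lemma evenperm_involution:
  assumes "finite S" "\<sigma> permutes S" "\<And>x. \<sigma> (\<sigma> x) = x"
  shows "\<exists>k. card {x. \<sigma> x \<noteq> x} = 2 * k \<and> (evenperm \<sigma> \<longleftrightarrow> even k)"
  using assms(2,3)
proof (induction "card {x. \<sigma> x \<noteq> x}" arbitrary: \<sigma> rule: less_induct)
  case less
  have fin: "finite {x. \<sigma> x \<noteq> x}"
    by (rule finite_subset[OF _ assms(1)]) (use less.prems(1) in \<open>auto simp: permutes_def\<close>)
  show ?case
  proof (cases "\<forall>x. \<sigma> x = x")
    case True
    then have "\<sigma> = id" by auto
    then show ?thesis by (intro exI[of _ 0]) auto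
  next
    case False
    then obtain a where a: "\<sigma> a \<noteq> a" by blast
    define \<tau> where "\<tau> = \<sigma> \<circ> transpose a (\<sigma> a)"
    have aS: "a \<in> S" "\<sigma> a \<in> S"
      using a less.prems by (metis permutes_not_in)+
    then have tp: "\<tau> permutes S"
      unfolding \<tau>_def using less.prems(1) by (intro permutes_compose permutes_swap_id)
    have \<tau>: "\<tau> x = (if x = a \<or> x = \<sigma> a then x else \<sigma> x)" for x
      using less.prems(2)[of a] by (simp add: \<tau>_def transpose_def)
    have moved: "{x. \<sigma> x \<noteq> x} = insert a (insert (\<sigma> a) {x. \<tau> x \<noteq> x})"
      using a less.prems(2)[of a] by (auto simp: \<tau>)
    have notin: "a \<notin> {x. \<tau> x \<noteq> x}" "\<sigma> a \<notin> {x. \<tau> x \<noteq> x}"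
      by (simp_all add: \<tau>)
    have "finite {x. \<tau> x \<noteq> x}"
      using fin moved by simp
    then have card: "card {x. \<sigma> x \<noteq> x} = 2 + card {x. \<tau> x \<noteq> x}"
      using notin a unfolding moved by simp
    have "\<tau> (\<tau> x) = x" for x
      using less.prems(2)[of x] less.prems(2)[of a] by (auto simp: \<tau>)
    then obtain k where k: "card {x. \<tau> x \<noteq> x} = 2 * k" "evenperm \<tau> \<longleftrightarrow> even k"
      using less.hyps[OF _ tp] card by auto
    have "evenperm \<tau> \<longleftrightarrow> \<not> evenperm \<sigma>"
      unfolding \<tau>_def using less.prems(1) assms(1) a
      by (subst evenperm_comp) (auto simp: evenperm_swap permutation_swap_id intro: permutes_imp_permutation)
    then show ?thesis
      using k card by (intro exI[of _ "Suc k"]) auto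
  qed
qed

text \<open>Points that are not fixed pair off with their images; extending \<open>f\<close> by the
  identity outside \<open>S\<close> gives an involution of the whole type.\<close>

lemma even_card_iff_even_card_fixpoints:
  assumes "finite S" "\<And>x. x \<in> S \<Longrightarrow> f x \<in> S" "\<And>x. x \<in> S \<Longrightarrow> f (f x) = x"
  shows "even (card S) \<longleftrightarrow> even (card {x \<in> S. f x = x})"
proof -
  define \<sigma> where "\<sigma> = (\<lambda>x. if x \<in> S then f x else x)"
  have inv: "\<sigma> (\<sigma> x) = x" for x
    using assms by (simp add: \<sigma>_def)
  then have "bij \<sigma>"
    by (intro o_bij[of \<sigma> \<sigma>]) auto
  then have "\<sigma> permutes S"
    by (auto simp: permutes_def \<sigma>_def bij_iff)
  then have "even (card {x. \<sigma> x \<noteq> x})"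
    using evenperm_involution[OF assms(1) _ inv] by auto
  moreover have "{x. \<sigma> x \<noteq> x} = S - {x \<in> S. f x = x}"
    by (auto simp: \<sigma>_def)
  moreover have "card (S - {x \<in> S. f x = x}) + card {x \<in> S. f x = x} = card S"
    using assms(1) by (metis (no_types, lifting) card_Diff_subset card_mono finite_subset
        le_add_diff_inverse2 mem_Collect_eq subsetI)
  ultimately show ?thesis by (metis even_add)
qed

section \<open>Squares and conics\<close>

definition nz_squares :: "'a::field set" where
  "nz_squares = {a. a \<noteq> 0 \<and> (\<exists>t. t\<^sup>2 = a)}"

text \<open>For \<open>a \<noteq> 0\<close> in odd characteristic this is one plus the quadratic
  character of \<open>a\<close>.\<close>

definition n_sqrt :: "'a::field \<Rightarrow> nat" where
  "n_sqrt a = card {t. t\<^sup>2 = a}"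

text \<open>Points on the axes are left out so that the sign changes of \<open>u\<close> and
  \<open>w\<close> act freely in odd characteristic.\<close>

definition conic :: "'a::field \<Rightarrow> ('a \<times> 'a) set" where
  "conic k = {(u, w). k * u\<^sup>2 + w\<^sup>2 = 1 \<and> u \<noteq> 0 \<and> w \<noteq> 0}"

text \<open>Parametrises, by \<open>a = u\<^sup>2\<close>, the orbits of the sign changes on
  \<open>conic k\<close>.\<close>

definition square_pts :: "'a::field \<Rightarrow> 'a set" where
  "square_pts k = {a \<in> nz_squares. 1 - k * a \<in> nz_squares}"

lemma square_mem_nz_squares [simp]: "t\<^sup>2 \<in> nz_squares \<longleftrightarrow> t \<noteq> 0" for t :: "'a::field"
  by (auto simp: nz_squares_def)

lemma four_neq_0: "(2::'a::field) \<noteq> 0 \<Longrightarrow> (4::'a) \<noteq> 0"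
  using mult_eq_0_iff[of "2::'a" 2] by simp

lemma n_sqrt_eq:
  fixes a :: "'a::field"
  assumes two: "(2::'a) \<noteq> 0" and "a \<noteq> 0"
  shows "n_sqrt a = (if a \<in> nz_squares then 2 else 0)"
proof (cases "a \<in> nz_squares")
  case True
  then obtain t where t: "t\<^sup>2 = a" "t \<noteq> 0"
    by (auto simp: nz_squares_def)
  have "t \<noteq> - t"
    using two t(2) by (simp add: eq_neg_iff_add_eq_0 flip: mult_2)
  moreover have "{s. s\<^sup>2 = a} = {t, - t}"
    using t by (auto simp: power2_eq_iff)
  ultimately show ?thesis
    using True by (simp add: n_sqrt_def)
next
  case False
  then have "{t. t\<^sup>2 = a} = {}"
    using assms(2) by (auto simp: nz_squares_def)
  then show ?thesis
    using False by (simp add: n_sqrt_def)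
qed

lemma card_conic_eq_card_square_pts:
  fixes k :: "'a::{field, finite}"
  assumes two: "(2::'a) \<noteq> 0"
  shows "card (conic k) = 4 * card (square_pts k)"
proof (rule card_eq_mult_card_if_fibres[where f = "\<lambda>(u, w). u\<^sup>2"])
  have w: "1 - k * u\<^sup>2 = w\<^sup>2" if "k * u\<^sup>2 + w\<^sup>2 = 1" for u w :: 'a
    using that by (simp add: algebra_simps)
  show "(\<lambda>(u, w). u\<^sup>2) ` conic k \<subseteq> square_pts k"
    by (auto simp: conic_def square_pts_def w)
  fix a assume a: "a \<in> square_pts k"
  have "{x \<in> conic k. (\<lambda>(u, w). u\<^sup>2) x = a} = {u. u\<^sup>2 = a} \<times> {w. w\<^sup>2 = 1 - k * a}"
    using a by (auto simp: conic_def square_pts_def nz_squares_def algebra_simps)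
  then have "card {x \<in> conic k. (\<lambda>(u, w). u\<^sup>2) x = a} = n_sqrt a * n_sqrt (1 - k * a)"
    by (simp add: n_sqrt_def card_cartesian_product)
  also have "\<dots> = 4"
  proof -
    have "a \<noteq> 0" "1 - k * a \<noteq> 0"
      using a by (auto simp: square_pts_def nz_squares_def)
    then show ?thesis
      using a by (simp add: n_sqrt_eq[OF two] square_pts_def)
  qed
  finally show "card {x \<in> conic k. (\<lambda>(u, w). u\<^sup>2) x = a} = 4" .
qed auto

text \<open>The lines through \<open>(0, 1)\<close>, with slope \<open>t\<close>, parametrise the conic.\<close>

lemma card_conic:
  fixes k :: "'a::{field, finite}"
  assumes two: "(2::'a) \<noteq> 0" and k: "k \<noteq> 0"
  shows "card (conic k) + n_sqrt (- k) + n_sqrt (1 / k) + 1 = CARD('a)"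
proof -
  let ?A = "{(u, w). k * u\<^sup>2 + w\<^sup>2 = 1 \<and> u \<noteq> 0}"
  \<comment> \<open>Slope \<open>0\<close> is the tangent at \<open>(0, 1)\<close>; for
    \<open>t\<^sup>2 = - k\<close> the line has no second intersection with the curve.\<close>
  let ?T = "UNIV - insert 0 {t. t\<^sup>2 = - k}"
  let ?Z = "(\<lambda>u. (u, 0)) ` {u. u\<^sup>2 = 1 / k}"
  define F :: "'a \<times> 'a \<Rightarrow> 'a" where "F = (\<lambda>(u, w). (w - 1) / u)"
  \<comment> \<open>The second intersection of \<open>w = 1 + t * u\<close> with the curve, found
    from \<open>(k + t\<^sup>2) * u = - 2 * t\<close>.\<close>
  define G where "G = (\<lambda>t. (- 2 * t / (k + t\<^sup>2), (k - t\<^sup>2) / (k + t\<^sup>2)))"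
  have A: "G (F (u, w)) = (u, w) \<and> F (u, w) \<noteq> 0 \<and> (F (u, w))\<^sup>2 \<noteq> - k"
    if *: "k * u\<^sup>2 + w\<^sup>2 = 1" "u \<noteq> 0" for u w :: 'a
  proof -
    \<comment> \<open>On the curve \<open>c\<close> equals
      \<open>k * u\<^sup>2 + (w - 1)\<^sup>2\<close>, so for the slope \<open>t\<close> it is
      \<open>u\<^sup>2\<close> times the denominator \<open>k + t\<^sup>2\<close> in
      \<open>G\<close>.\<close>
    define c where "c = 2 * (1 - w)"
    have w1: "w \<noteq> 1"
      using * k by auto
    then have c: "c \<noteq> 0"
      using two by (simp add: c_def)
    have "k * u\<^sup>2 = 1 - w\<^sup>2"
      using *(1) by (simp add: eq_diff_eq)
    then have "k * u\<^sup>2 + (w - 1)\<^sup>2 = c" "k * u\<^sup>2 - (w - 1)\<^sup>2 = w * c"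
      by (simp_all add: c_def power2_eq_square algebra_simps)
    then have kt: "k + ((w - 1) / u)\<^sup>2 = c / u\<^sup>2" "k - ((w - 1) / u)\<^sup>2 = w * c / u\<^sup>2"
      using *(2) by (simp_all add: power_divide field_simps)
    have "- 2 * ((w - 1) / u) = c / u"
      using * by (simp add: c_def field_simps)
    then have "- 2 * ((w - 1) / u) / (c / u\<^sup>2) = u" "w * c / u\<^sup>2 / (c / u\<^sup>2) = w"
      using *(2) c by (simp_all add: power2_eq_square)
    then have "G (F (u, w)) = (u, w)"
      by (simp only: F_def G_def prod.case kt)
    moreover have "k + ((w - 1) / u)\<^sup>2 \<noteq> 0"
      using kt(1) c *(2) by simp
    ultimately show ?thesis
      using w1 *(2) by (auto simp: F_def)
  qed
  have T: "F (G t) = t \<and> k * (fst (G t))\<^sup>2 + (snd (G t))\<^sup>2 = 1 \<and> fst (G t) \<noteq> 0"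
    if *: "t \<noteq> 0" "t\<^sup>2 \<noteq> - k" for t
  proof -
    define d where "d = k + t\<^sup>2"
    have d: "d \<noteq> 0"
      using *(2) by (simp add: d_def add_eq_0_iff)
    have u: "- 2 * t / d \<noteq> 0"
      using d * two by simp
    have "k - t\<^sup>2 - d = t * (- 2 * t)"
      by (simp add: d_def power2_eq_square)
    then have "(k - t\<^sup>2) / d - 1 = t * (- 2 * t) / d"
      using d by (metis diff_divide_distrib divide_self)
    then have "(k - t\<^sup>2) / d - 1 = t * (- 2 * t / d)"
      by simp
    then have "((k - t\<^sup>2) / d - 1) / (- 2 * t / d) = t"
      using u by (metis nonzero_mult_div_cancel_right)
    moreover have "k * (- 2 * t)\<^sup>2 + (k - t\<^sup>2)\<^sup>2 = d\<^sup>2"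
      by (simp add: d_def power2_eq_square algebra_simps)
    then have "(k * (- 2 * t)\<^sup>2 + (k - t\<^sup>2)\<^sup>2) / d\<^sup>2 = 1"
      using d by simp
    then have "k * (- 2 * t / d)\<^sup>2 + ((k - t\<^sup>2) / d)\<^sup>2 = 1"
      by (simp add: power_divide add_divide_distrib)
    ultimately show ?thesis
      using u by (simp only: F_def G_def prod.case fst_conv snd_conv d_def) simp
  qed
  have "bij_betw F ?A ?T"
  proof (rule bij_betw_byWitness[where f' = G])
    show "\<forall>a\<in>?A. G (F a) = a" "F ` ?A \<subseteq> ?T"
      using A by auto
    show "\<forall>t\<in>?T. F (G t) = t" "G ` ?T \<subseteq> ?A"
      using T by (simp_all add: image_subset_iff case_prod_beta)
  qed
  then have "card ?A = card ?T"
    by (rule bij_betw_same_card)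
  also have "\<dots> + (1 + n_sqrt (- k)) = CARD('a)"
  proof -
    have "card (insert 0 {t. t\<^sup>2 = - k}) = 1 + n_sqrt (- k)"
      using k by (simp add: n_sqrt_def)
    then show ?thesis
      by (metis card_Diff_subset card_mono finite le_add_diff_inverse2 subset_UNIV)
  qed
  finally have A: "card ?A + (1 + n_sqrt (- k)) = CARD('a)" .
  \<comment> \<open>The parametrised set still contains the points with \<open>w = 0\<close>, which
    \<open>conic k\<close> omits.\<close>
  have "?A = conic k \<union> ?Z"
    using k by (auto simp: conic_def field_simps)
  moreover have "conic k \<inter> ?Z = {}"
    by (auto simp: conic_def)
  moreover have "card ?Z = n_sqrt (1 / k)"
    unfolding n_sqrt_def by (intro card_image inj_onI) simp
  ultimately have "card ?A = card (conic k) + n_sqrt (1 / k)"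
    by (simp add: card_Un_disjoint)
  then show ?thesis
    using A by simp
qed

text \<open>For the parity, \<open>a \<mapsto> 1 - a\<close> is an involution of
  \<open>square_pts 1\<close> whose only possible fixed point is \<open>1 / 2\<close>.\<close>

lemma conic_parameters:
  assumes two: "(2::'a::{field, finite}) \<noteq> 0"
  shows "CARD('a) = 4 * card (square_pts (1::'a)) + n_sqrt (- 1 :: 'a) + 3"
    and "CARD('a) = 4 * card (square_pts (2::'a)) + n_sqrt (- 2 :: 'a) + n_sqrt (1 / 2 :: 'a) + 1"
    and "even (card (square_pts (1::'a))) \<longleftrightarrow> n_sqrt (1 / 2 :: 'a) = 0"
proof -
  have one: "(1::'a) \<in> nz_squares"
    using square_mem_nz_squares[of "1::'a"] by simp
  have "n_sqrt (1 / 1 :: 'a) = 2"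
    using n_sqrt_eq[OF two, of 1] one by simp
  then show "CARD('a) = 4 * card (square_pts (1::'a)) + n_sqrt (- 1 :: 'a) + 3"
    using card_conic[OF two, of 1] card_conic_eq_card_square_pts[OF two, of 1] by simp
  show "CARD('a) = 4 * card (square_pts (2::'a)) + n_sqrt (- 2 :: 'a) + n_sqrt (1 / 2 :: 'a) + 1"
    using card_conic[OF two, of 2] card_conic_eq_card_square_pts[OF two, of 2] two by simp
  have half: "1 - a = a \<longleftrightarrow> a = 1 / 2" for a :: 'a
    using two by (auto simp: field_simps mult_2)
  have "even (card (square_pts (1::'a))) \<longleftrightarrow> even (card {a \<in> square_pts (1::'a). 1 - a = a})"
    by (rule even_card_iff_even_card_fixpoints) (auto simp: square_pts_def)
  also have "{a \<in> square_pts (1::'a). 1 - a = a} = {a \<in> nz_squares. 1 - a = a}"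
    unfolding square_pts_def mult_1_left by (rule Collect_cong) (metis (no_types, lifting) mem_Collect_eq)
  also have "\<dots> = (if 1 / 2 \<in> (nz_squares :: 'a set) then {1 / 2} else {})"
  proof -
    have "{a \<in> S. a = c} = (if c \<in> S then {c} else {})" for S :: "'a set" and c
      by auto
    then show ?thesis
      unfolding half .
  qed
  also have "even (card \<dots>) \<longleftrightarrow> n_sqrt (1 / 2 :: 'a) = 0"
    using n_sqrt_eq[OF two, of "1 / 2"] two by simp
  finally show "even (card (square_pts (1::'a))) \<longleftrightarrow> n_sqrt (1 / 2 :: 'a) = 0" .
qed

lemma n_sqrt_cases:
  fixes a :: "'a::field"
  assumes "(2::'a) \<noteq> 0" "a \<noteq> 0"
  shows "n_sqrt a = 0 \<or> n_sqrt a = 2"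
  using n_sqrt_eq[OF assms] by auto

text \<open>The conics for \<open>k = 1\<close> and \<open>k = 2\<close> give two expressions for
  \<open>CARD('a)\<close>. Each root count is 0 or 2, so equating them determines \<open>s2\<close>
  from \<open>s1\<close> and \<open>r1\<close>, while the parity of \<open>s1\<close> fixes
  \<open>r3\<close>.\<close>

lemma even_card_square_pts_2:
  assumes two: "(2::'a::{field, finite}) \<noteq> 0"
  shows "even (card (square_pts (2::'a))) \<longleftrightarrow> CARD('a) mod 8 = 3"
proof -
  define s1 s2 r1 r2 r3
    where "s1 = card (square_pts (1::'a))" and s2: "s2 = card (square_pts (2::'a))"
      and "r1 = n_sqrt (- 1 :: 'a)" and "r2 = n_sqrt (- 2 :: 'a)" and "r3 = n_sqrt (1 / 2 :: 'a)"
  note defs = this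
  have r: "r1 = 0 \<or> r1 = 2" "r2 = 0 \<or> r2 = 2" "r3 = 0 \<or> r3 = 2"
    unfolding defs using two by (auto intro!: n_sqrt_cases[OF two])
  have q: "CARD('a) = 4 * s1 + r1 + 3"
    unfolding defs by (rule conic_parameters(1)[OF two])
  have "CARD('a) = 4 * s2 + r2 + r3 + 1"
    unfolding defs by (rule conic_parameters(2)[OF two])
  then have eq: "4 * s1 + r1 + 2 = 4 * s2 + r2 + r3"
    using q by linarith
  have e: "even s1 \<longleftrightarrow> r3 = 0"
    unfolding defs by (rule conic_parameters(3)[OF two])
  show ?thesis
  proof (cases "even s1")
    case True
    then obtain m where m: "s1 = 2 * m" by (rule evenE)
    \<comment> \<open>Here \<open>r3 = 0\<close>, and modulo 4 exactly one of \<open>r1\<close>,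
      \<open>r2\<close> is 2; the field size is \<open>8 * m + 3\<close> or
      \<open>8 * m + 5\<close>.\<close>
    from r e True eq m have "r1 = 0 \<and> s2 = 2 * m \<or> r1 = 2 \<and> s2 = 2 * m + 1"
      by auto
    then show ?thesis
      using q m s2 by auto
  next
    case False
    then obtain m where m: "s1 = 2 * m + 1" by (rule oddE)
    \<comment> \<open>Here \<open>r3 = 2\<close>, which forces \<open>r1 = r2\<close> and
      \<open>s2 = s1\<close>; the field size is 7 or 1 modulo 8.\<close>
    from r e False eq m have "(r1 = 0 \<or> r1 = 2) \<and> s2 = 2 * m + 1"
      by auto
    then show ?thesis
      using q m s2 by auto
  qed
qed

text \<open>Used for the swap: the first fact excludes zero coordinates on \<open>X_star\<close>,
  the second keeps the circle \<open>conic 1\<close> off the lines \<open>u = v\<close> and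
  \<open>u = - v\<close>.\<close>

lemma nonsquares_if_card_mod_8_eq_3:
  assumes two: "(2::'a::{field, finite}) \<noteq> 0" and q: "CARD('a) mod 8 = 3"
  shows "(- 1 :: 'a) \<notin> nz_squares" "(1 / 2 :: 'a) \<notin> nz_squares"
    and "card (conic (1::'a)) + 3 = CARD('a)"
proof -
  note r = n_sqrt_cases[OF two]
  have "n_sqrt (- 1 :: 'a) = 0 \<or> n_sqrt (- 1 :: 'a) = 2" "n_sqrt (1 / 2 :: 'a) = 0 \<or> n_sqrt (1 / 2 :: 'a) = 2"
    using two by (auto intro!: r)
  then have 0: "n_sqrt (- 1 :: 'a) = 0 \<and> n_sqrt (1 / 2 :: 'a) = 0"
    using conic_parameters(1,3)[OF two] q by (elim disjE; simp only:; presburger)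
  then show "(- 1 :: 'a) \<notin> nz_squares" "(1 / 2 :: 'a) \<notin> nz_squares"
    using n_sqrt_eq[OF two, of "- 1"] n_sqrt_eq[OF two, of "1 / 2"] two by (auto split: if_splits)
  show "card (conic (1::'a)) + 3 = CARD('a)"
    using 0 conic_parameters(1)[OF two] card_conic_eq_card_square_pts[OF two, of 1] by linarith
qed

section \<open>The sphere\<close>

text \<open>The substitution \<open>u = 2/x\<close>, \<open>v = 2/y\<close>, \<open>w = 2z/(xy) - 1\<close> completes the square in \<open>z\<close> and turns
  the Markoff equation into \<open>u\<^sup>2 + v\<^sup>2 + w\<^sup>2 = 1\<close>; the move \<open>m3\<close> becomes \<open>w \<mapsto> - w\<close>.\<close>

lemma card_sphere_chart:
  fixes P :: "'a::field \<Rightarrow> 'a \<Rightarrow> 'a \<Rightarrow> bool"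
  assumes two: "(2::'a) \<noteq> 0"
  shows "card {(x, y, z). (x, y, z) \<in> X_set \<and> x \<noteq> 0 \<and> y \<noteq> 0 \<and> P (2 / x) (2 / y) (2 * z / (x * y) - 1)}
    = card {(u, v, w). u\<^sup>2 + v\<^sup>2 + w\<^sup>2 = 1 \<and> u \<noteq> 0 \<and> v \<noteq> 0 \<and> P u v w}" (is "card ?X = card ?S")
proof -
  define F :: "'a point \<Rightarrow> 'a point" where "F = (\<lambda>(x, y, z). (2 / x, 2 / y, 2 * z / (x * y) - 1))"
  define G :: "'a point \<Rightarrow> 'a point" where "G = (\<lambda>(u, v, w). (2 / u, 2 / v, 2 * (w + 1) / (u * v)))"
  have FG: "F (G (u, v, w)) = (u, v, w)" if "u \<noteq> 0" "v \<noteq> 0" for u v w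
    using that two by (simp add: F_def G_def) (simp add: field_simps)
  have GF: "G (F (x, y, z)) = (x, y, z)" if "x \<noteq> 0" "y \<noteq> 0" for x y z
    using that two four_neq_0[OF two] by (simp add: F_def G_def)
  have eq: "(x, y, z) \<in> X_set \<longleftrightarrow> (2 / x)\<^sup>2 + (2 / y)\<^sup>2 + (2 * z / (x * y) - 1)\<^sup>2 = 1"
    if "x \<noteq> 0" "y \<noteq> 0" for x y z :: 'a
  proof -
    have "(2 / x)\<^sup>2 + (2 / y)\<^sup>2 + (2 * z / (x * y) - 1)\<^sup>2 - 1 = (2 / (x * y))\<^sup>2 * (x\<^sup>2 + y\<^sup>2 + z\<^sup>2 - x * y * z)"
      using that by (simp add: power2_eq_square field_simps)
    then have "(2 / x)\<^sup>2 + (2 / y)\<^sup>2 + (2 * z / (x * y) - 1)\<^sup>2 - 1 = 0 \<longleftrightarrow> x\<^sup>2 + y\<^sup>2 + z\<^sup>2 - x * y * z = 0"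
      using that two by simp
    then show ?thesis
      by (simp add: X_set_def)
  qed
  have FX: "F v \<in> ?S" if "v \<in> ?X" for v
    using that eq two by (auto simp: F_def)
  have GS: "G v \<in> ?X" if v: "v \<in> ?S" for v
  proof -
    obtain a b c where abc: "v = (a, b, c)" "a \<noteq> 0" "b \<noteq> 0" "a\<^sup>2 + b\<^sup>2 + c\<^sup>2 = 1" "P a b c"
      using v by auto
    obtain x y z where xyz: "G v = (x, y, z)"
      by (cases "G v")
    have nz: "x \<noteq> 0" "y \<noteq> 0"
      using xyz abc two by (auto simp: G_def)
    have "(2 / x, 2 / y, 2 * z / (x * y) - 1) = (a, b, c)"
      using FG[OF abc(2,3), of c] xyz by (simp add: abc(1) F_def)
    then show ?thesis
      using xyz nz eq[OF nz, of z] abc(4,5) by simp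
  qed
  have "bij_betw F ?X ?S"
  proof (rule bij_betw_byWitness[where f' = G])
    show "\<forall>v\<in>?X. G (F v) = v" "\<forall>v\<in>?S. F (G v) = v"
      using FG GF by auto
    show "F ` ?X \<subseteq> ?S"
      using FX by (rule image_subsetI)
    show "G ` ?S \<subseteq> ?X"
      using GS by (rule image_subsetI)
  qed
  then show ?thesis
    by (rule bij_betw_same_card)
qed

text \<open>Ordered decompositions of 1 into three nonzero squares, the third being determined by
  the other two.\<close>

definition square_pairs :: "('a::field \<times> 'a) set" where
  "square_pairs = {(a, b). a \<in> nz_squares \<and> b \<in> nz_squares \<and> 1 - a - b \<in> nz_squares}"

text \<open>Each fibre of squaring is a product of three two-element root sets, and \<open>P\<close>
  is constant on it.\<close>

lemma card_sphere:
  fixes P :: "'a::{field, finite} \<Rightarrow> 'a \<Rightarrow> bool"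
  assumes two: "(2::'a) \<noteq> 0"
  shows "card {(u, v, w). u\<^sup>2 + v\<^sup>2 + w\<^sup>2 = 1 \<and> u \<noteq> 0 \<and> v \<noteq> 0 \<and> w \<noteq> 0 \<and> P (u\<^sup>2) (v\<^sup>2)}
    = 8 * card {(a, b) \<in> square_pairs. P a b}" (is "card ?S = 8 * card ?B")
proof (rule card_eq_mult_card_if_fibres[where f = "\<lambda>(u, v, w). (u\<^sup>2, v\<^sup>2)"])
  have w: "1 - u\<^sup>2 - v\<^sup>2 = w\<^sup>2" if "u\<^sup>2 + v\<^sup>2 + w\<^sup>2 = 1" for u v w :: 'a
    using that by (simp add: algebra_simps)
  show "(\<lambda>(u, v, w). (u\<^sup>2, v\<^sup>2)) ` ?S \<subseteq> ?B"
    by (auto simp: square_pairs_def w)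
  fix c assume c: "c \<in> ?B"
  then obtain a b where ab: "c = (a, b)" "a \<in> nz_squares" "b \<in> nz_squares" "1 - a - b \<in> nz_squares" "P a b"
    by (auto simp: square_pairs_def)
  then have nz: "a \<noteq> 0" "b \<noteq> 0" "1 - a - b \<noteq> 0"
    by (auto simp: nz_squares_def)
  have "{s \<in> ?S. (\<lambda>(u, v, w). (u\<^sup>2, v\<^sup>2)) s = c} = {u. u\<^sup>2 = a} \<times> {v. v\<^sup>2 = b} \<times> {w. w\<^sup>2 = 1 - a - b}"
    using ab nz by (auto simp: algebra_simps)
  then have "card {s \<in> ?S. (\<lambda>(u, v, w). (u\<^sup>2, v\<^sup>2)) s = c} = n_sqrt a * (n_sqrt b * n_sqrt (1 - a - b))"
    by (simp add: n_sqrt_def card_cartesian_product)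
  also have "\<dots> = 8"
    using ab nz by (simp add: n_sqrt_eq[OF two])
  finally show "card {s \<in> ?S. (\<lambda>(u, v, w). (u\<^sup>2, v\<^sup>2)) s = c} = 8" .
qed auto

lemma swap_eq_self_iff: "prod.swap c = c \<longleftrightarrow> fst c = snd c"
proof (cases c)
  case (Pair a b)
  then show ?thesis
    unfolding Pair swap_simp prod.inject fst_conv snd_conv by blast
qed

text \<open>The exchange of the two entries fixes the pairs \<open>(a, a)\<close>, whose third
  square is \<open>1 - 2 * a\<close>.\<close>

lemma even_card_square_pairs:
  "even (card (square_pairs :: ('a::{field, finite} \<times> 'a) set)) \<longleftrightarrow> even (card (square_pts (2::'a)))"
proof -
  have "even (card (square_pairs :: ('a \<times> 'a) set))
      \<longleftrightarrow> even (card {c \<in> square_pairs :: ('a \<times> 'a) set. prod.swap c = c})"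
    by (rule even_card_iff_even_card_fixpoints) (auto simp: square_pairs_def algebra_simps)
  also have "{c \<in> square_pairs :: ('a \<times> 'a) set. prod.swap c = c} = (\<lambda>a. (a, a)) ` square_pts 2"
  proof -
    have "1 - 2 * a = 1 - a - a" for a :: 'a
      by (simp only: diff_diff_eq mult_2)
    then have "a \<in> square_pts 2 \<longleftrightarrow> (a, a) \<in> square_pairs" for a :: 'a
      unfolding square_pts_def square_pairs_def by (simp only: mem_Collect_eq prod.case simp_thms)
    then show ?thesis
      unfolding swap_eq_self_iff by auto
  qed
  also have "card \<dots> = card (square_pts (2::'a))"
    by (intro card_image inj_onI) simp
  finally show ?thesis .
qed

lemma even_card_square_pairs_off_diagonal:
  "even (card {(a, b) \<in> square_pairs :: ('a::{field, finite} \<times> 'a) set. a \<noteq> b})"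
proof -
  let ?S = "{(a, b) \<in> square_pairs :: ('a \<times> 'a) set. a \<noteq> b}"
  have "even (card ?S) \<longleftrightarrow> even (card {c \<in> ?S. prod.swap c = c})"
    by (rule even_card_iff_even_card_fixpoints) (auto simp: square_pairs_def algebra_simps)
  also have "{c \<in> ?S. prod.swap c = c} = {}"
    unfolding swap_eq_self_iff by auto
  finally show ?thesis by simp
qed

section \<open>Signs of induced permutations\<close>

lemma eq_uminus_iff_eq_0:
  fixes a :: "'a::field"
  assumes "(2::'a) \<noteq> 0"
  shows "a = - a \<longleftrightarrow> a = 0"
  using assms by (simp add: eq_neg_iff_add_eq_0 flip: mult_2)

lemma mem_N_orbit_iff: "w \<in> N_orbit v \<longleftrightarrow> N_orbit w = N_orbit v"
proof
  assume "w \<in> N_orbit v"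
  then show "N_orbit w = N_orbit v"
    by (cases v) (auto simp: N_orbit_eq n1_def n2_def n3_def)
qed (auto simp: N_orbit_eq)

lemma N_orbit_subset_X_star: "v \<in> X_star \<Longrightarrow> N_orbit v \<subseteq> X_star"
  by (cases v) (auto simp: N_orbit_eq n1_def n2_def n3_def X_star_def X_set_def)

text \<open>Two zero coordinates force the third to vanish. In odd characteristic this makes
  \<open>N\<close> act freely, as each \<open>n1\<close>, \<open>n2\<close>, \<open>n3\<close>
  negates two coordinates.\<close>

lemma X_star_two_zeros:
  fixes x y z :: "'a::field"
  assumes "(x, y, z) \<in> X_star"
  shows "\<not> (x = 0 \<and> y = 0)" "\<not> (x = 0 \<and> z = 0)" "\<not> (y = 0 \<and> z = 0)"
  using assms by (auto simp: X_star_def X_set_def)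

lemma card_N_orbit:
  fixes v :: "'a::field point"
  assumes two: "(2::'a) \<noteq> 0" and v: "v \<in> X_star"
  shows "card (N_orbit v) = 4"
proof -
  obtain x y z where xyz: "v = (x, y, z)"
    by (cases v)
  note e = eq_uminus_iff_eq_0[OF two]
  have "- a = a \<longleftrightarrow> a = 0" for a :: 'a
    using e[of a] by auto
  then have "distinct [v, n1 v, n2 v, n3 v]"
    using X_star_two_zeros[of x y z] v xyz e by (auto simp: n1_def n2_def n3_def)
  then have "card (set [v, n1 v, n2 v, n3 v]) = 4"
    by (subst distinct_card) auto
  then show ?thesis
    by (simp add: N_orbit_eq)
qed

text \<open>With \<open>k\<close> 2-cycles there are \<open>2 * k\<close> moved orbits of 4 points
  each, hence \<open>8 * k\<close> points, and \<open>k\<close> is even iff 16 divides this.\<close>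

lemma evenperm_induced_involution:
  fixes f :: "'a::{field, finite} point \<Rightarrow> 'a point"
  assumes two: "(2::'a) \<noteq> 0"
    and X: "f ` X_star \<subseteq> X_star" and equiv: "\<And>v. f ` N_orbit v = N_orbit (f v)"
    and inv: "\<And>v. f (f v) = v"
  shows "evenperm (induced_perm f) \<longleftrightarrow> 16 dvd card {v \<in> X_star. f v \<notin> N_orbit v}"
proof -
  have perm: "induced_perm f permutes Y_set"
    by (rule induced_perm_permutes[OF X equiv X equiv inv inv])
  have "induced_perm f (induced_perm f B) = B" for B
  proof (cases "B \<in> Y_set")
    case True
    then have "induced_perm f B \<in> Y_set"
      using perm by (simp add: permutes_in_image)
    then show ?thesis
      using True by (simp add: induced_perm_def image_image inv)
  qed (simp add: induced_perm_def)
  then obtain k where k: "card {B. induced_perm f B \<noteq> B} = 2 * k" "evenperm (induced_perm f) \<longleftrightarrow> even k"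
    using evenperm_involution[OF _ perm] by auto
  have "card {v \<in> X_star. f v \<notin> N_orbit v} = 4 * card {B. induced_perm f B \<noteq> B}"
  proof (rule card_eq_mult_card_if_fibres[where f = N_orbit])
    have moved: "induced_perm f (N_orbit v) \<noteq> N_orbit v \<longleftrightarrow> f v \<notin> N_orbit v" if "v \<in> X_star" for v
      using that by (simp add: induced_perm_def Y_set_def equiv mem_N_orbit_iff)
    then show "N_orbit ` {v \<in> X_star. f v \<notin> N_orbit v} \<subseteq> {B. induced_perm f B \<noteq> B}"
      by auto
    fix B assume B: "B \<in> {B. induced_perm f B \<noteq> B}"
    then have "B \<in> Y_set"
      by (auto simp: induced_perm_def split: if_splits)
    then obtain v where v: "v \<in> X_star" "B = N_orbit v"
      by (auto simp: Y_set_def)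
    \<comment> \<open>Being moved depends only on the orbit, so the fibre over \<open>B\<close> is
      all of \<open>B\<close>.\<close>
    have "{w \<in> {w \<in> X_star. f w \<notin> N_orbit w}. N_orbit w = B} = B"
    proof (intro equalityI subsetI)
      fix w assume "w \<in> {w \<in> {w \<in> X_star. f w \<notin> N_orbit w}. N_orbit w = B}"
      then show "w \<in> B"
        using v mem_N_orbit_iff by blast
    next
      fix w assume "w \<in> B"
      then have "w \<in> X_star" "N_orbit w = B"
        using v N_orbit_subset_X_star mem_N_orbit_iff by blast+
      then show "w \<in> {w \<in> {w \<in> X_star. f w \<notin> N_orbit w}. N_orbit w = B}"
        using moved[of w] B by simp
    qed
    then show "card {w \<in> {w \<in> X_star. f w \<notin> N_orbit w}. N_orbit w = B} = 4"
      using card_N_orbit[OF two] v by simp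
  qed auto
  then show ?thesis
    using k by auto
qed

lemma evenperm_induced_m3:
  assumes two: "(2::'a::{field, finite}) \<noteq> 0"
  shows "evenperm (induced_perm (m3 :: 'a point \<Rightarrow> 'a point)) \<longleftrightarrow> CARD('a) mod 8 = 3"
proof -
  note e = eq_uminus_iff_eq_0[OF two]
  have "evenperm (induced_perm (m3 :: 'a point \<Rightarrow> 'a point))
      \<longleftrightarrow> 16 dvd card {v \<in> X_star :: 'a point set. m3 v \<notin> N_orbit v}"
  proof (rule evenperm_induced_involution[OF two])
    show "m3 ` X_star \<subseteq> (X_star :: 'a point set)"
      by (auto simp: X_star_def X_set_def m3_def power2_eq_square algebra_simps)
  qed (simp_all add: N_orbit_eq n1_def n2_def n3_def m3_def split_beta)
  also have "{v \<in> X_star :: 'a point set. m3 v \<notin> N_orbit v}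
    = {(x, y, z). (x, y, z) \<in> X_set \<and> x \<noteq> 0 \<and> y \<noteq> 0 \<and> 2 * z / (x * y) - 1 \<noteq> 0}"
  proof -
    have "(x, y, z) \<in> X_star \<and> m3 (x, y, z) \<notin> N_orbit (x, y, z) \<longleftrightarrow>
      (x, y, z) \<in> X_set \<and> x \<noteq> 0 \<and> y \<noteq> 0 \<and> 2 * z / (x * y) - 1 \<noteq> 0" for x y z :: 'a
    proof (cases "x = 0 \<or> y = 0")
      case True
      \<comment> \<open>Now \<open>m3\<close> only negates \<open>z\<close>, which \<open>n2\<close>
        does when \<open>x = 0\<close> and \<open>n1\<close> when \<open>y = 0\<close>.\<close>
      then have "m3 (x, y, z) \<in> N_orbit (x, y, z)"
        by (auto simp: N_orbit_eq n1_def n2_def n3_def m3_def)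
      then show ?thesis
        using True by blast
    next
      case False
      \<comment> \<open>Each of \<open>n1\<close>, \<open>n2\<close>, \<open>n3\<close> changes a
        nonzero \<open>x\<close> or \<open>y\<close>, so only the identity can agree with
        \<open>m3\<close>.\<close>
      then have "m3 (x, y, z) \<in> N_orbit (x, y, z) \<longleftrightarrow> x * y - z = z"
        by (simp add: N_orbit_eq n1_def n2_def n3_def m3_def e)
      also have "\<dots> \<longleftrightarrow> 2 * z = x * y"
        by (metis diff_eq_eq mult_2)
      also have "\<dots> \<longleftrightarrow> 2 * z / (x * y) - 1 = 0"
        using False by simp
      finally show ?thesis
        using False by (simp add: X_star_def)
    qed
    then show ?thesis
      by (simp only: set_eq_iff split_paired_All mem_Collect_eq prod.case simp_thms)
  qed
  also have "card \<dots> = 8 * card (square_pairs :: ('a \<times> 'a) set)"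
    using card_sphere_chart[OF two, of "\<lambda>_ _ w. w \<noteq> 0"] card_sphere[OF two, of "\<lambda>_ _. True"] by simp
  also have "16 dvd \<dots> \<longleftrightarrow> even (card (square_pairs :: ('a \<times> 'a) set))"
    by presburger
  finally show ?thesis
    using even_card_square_pairs even_card_square_pts_2[OF two] by metis
qed

lemma evenperm_induced_swap:
  assumes two: "(2::'a::{field, finite}) \<noteq> 0" and q: "CARD('a) mod 8 = 3"
  shows "evenperm (induced_perm (\<lambda>(x, y, z). (y, x, z) :: 'a point)) \<longleftrightarrow> CARD('a) mod 16 = 3"
proof -
  let ?s = "\<lambda>(x, y, z). (y, x, z) :: 'a point"
  note e = eq_uminus_iff_eq_0[OF two]
  note ns = nonsquares_if_card_mod_8_eq_3[OF two q]
  have "evenperm (induced_perm ?s) \<longleftrightarrow> 16 dvd card {v \<in> X_star. ?s v \<notin> N_orbit v}"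
  proof (rule evenperm_induced_involution[OF two])
    show "?s ` X_star \<subseteq> X_star"
      by (auto simp: X_star_def X_set_def algebra_simps)
  qed (auto simp: N_orbit_eq n1_def n2_def n3_def)
  also have "{v \<in> X_star. ?s v \<notin> N_orbit v}
    = {(x, y, z). (x, y, z) \<in> X_set \<and> x \<noteq> 0 \<and> y \<noteq> 0 \<and> (2 / x)\<^sup>2 \<noteq> (2 / y)\<^sup>2}"
  proof -
    have sq: "(2 / x)\<^sup>2 = (2 / y)\<^sup>2 \<longleftrightarrow> x = y \<or> x = - y" if "x \<noteq> 0" "y \<noteq> 0" for x y :: 'a
      using that two four_neq_0[OF two] by (auto simp: power2_eq_iff field_simps)
    \<comment> \<open>As \<open>- 1\<close> is not a square, a sum of two squares vanishes only
      trivially; a point with \<open>x = 0\<close> or \<open>y = 0\<close> would thus be the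
      origin.\<close>
    have sum0: "a = 0" if "a\<^sup>2 + b\<^sup>2 = 0" for a b :: 'a
    proof (rule ccontr)
      assume a: "a \<noteq> 0"
      have "b\<^sup>2 = - (a\<^sup>2)"
        using that by (simp add: eq_neg_iff_add_eq_0 add.commute)
      then have "(b / a)\<^sup>2 = - 1"
        using a by (simp add: power_divide)
      then show False
        using ns(1) square_mem_nz_squares[of "b / a"] by (metis neg_equal_0_iff_equal zero_neq_one zero_power2)
    qed
    have nz: "x \<noteq> 0" "y \<noteq> 0" if v: "(x, y, z) \<in> X_star" for x y z :: 'a
    proof -
      show "x \<noteq> 0"
        using v sum0[of y z] by (auto simp: X_star_def X_set_def)
      show "y \<noteq> 0"
        using v sum0[of x z] by (auto simp: X_star_def X_set_def)
    qed
    \<comment> \<open>The identity accounts for \<open>x = y\<close> and \<open>n3\<close> for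
      \<open>x = - y\<close>; \<open>n1\<close> and \<open>n2\<close> would force
      \<open>x = - x\<close>.\<close>
    have orb: "(y, x, z) \<in> N_orbit (x, y, z) \<longleftrightarrow> x = y \<or> x = - y" if "x \<noteq> 0" "y \<noteq> 0" for x y z :: 'a
      using that e[of x] e[of y] by (auto simp: N_orbit_eq n1_def n2_def n3_def)
    have X: "(x, y, z) \<in> X_star \<longleftrightarrow> (x, y, z) \<in> X_set" if "x \<noteq> 0" for x y z :: 'a
      using that by (simp add: X_star_def)
    have "(x, y, z) \<in> X_star \<and> (y, x, z) \<notin> N_orbit (x, y, z) \<longleftrightarrow>
      (x, y, z) \<in> X_set \<and> x \<noteq> 0 \<and> y \<noteq> 0 \<and> (2 / x)\<^sup>2 \<noteq> (2 / y)\<^sup>2" for x y z :: 'a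
      using orb[of x y z] sq[of x y] nz[of x y z] X[of x y z] by blast
    then show ?thesis
      by (simp only: set_eq_iff split_paired_All mem_Collect_eq prod.case simp_thms)
  qed
  also have "card \<dots> = card {(u, v, w). u\<^sup>2 + v\<^sup>2 + w\<^sup>2 = 1 \<and> u \<noteq> 0 \<and> v \<noteq> 0 \<and> u\<^sup>2 \<noteq> (v\<^sup>2 :: 'a)}"
    using card_sphere_chart[OF two, of "\<lambda>u v _. u\<^sup>2 \<noteq> v\<^sup>2"] by simp
  also have "{(u, v, w). u\<^sup>2 + v\<^sup>2 + w\<^sup>2 = 1 \<and> u \<noteq> 0 \<and> v \<noteq> 0 \<and> u\<^sup>2 \<noteq> (v\<^sup>2 :: 'a)}
    = {(u, v, w). u\<^sup>2 + v\<^sup>2 + w\<^sup>2 = 1 \<and> u \<noteq> 0 \<and> v \<noteq> 0 \<and> w \<noteq> 0 \<and> u\<^sup>2 \<noteq> (v\<^sup>2 :: 'a)}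
      \<union> (\<lambda>(u, v). (u, v, 0)) ` conic 1" (is "?L = ?M \<union> ?C")
  proof -
    \<comment> \<open>For \<open>w = 0\<close> the condition
      \<open>u\<^sup>2 \<noteq> v\<^sup>2\<close> is automatic, since equality would make
      \<open>1 / 2\<close> a square; hence \<open>?C\<close> is the entire circle.\<close>
    have "u\<^sup>2 \<noteq> v\<^sup>2" if "u\<^sup>2 + v\<^sup>2 = 1" "u \<noteq> 0" for u v :: 'a
    proof
      assume "u\<^sup>2 = v\<^sup>2"
      then have "2 * u\<^sup>2 = 1"
        using that(1) by (metis mult_2)
      then have "u\<^sup>2 = 1 / 2"
        using two by (simp add: eq_divide_eq mult.commute)
      then show False
        using that ns(2) by (metis square_mem_nz_squares)
    qed
    then show ?thesis
      by (auto simp: conic_def)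
  qed
  also have "card (?M \<union> ?C) = card ?M + card ?C"
    by (intro card_Un_disjoint) auto
  also have "card ?C = card (conic (1::'a))"
    by (intro card_image inj_onI) auto
  also have "card ?M = 8 * card {(a, b) \<in> square_pairs :: ('a \<times> 'a) set. a \<noteq> b}"
    by (rule card_sphere[OF two])
  finally have even: "evenperm (induced_perm ?s) \<longleftrightarrow>
    16 dvd 8 * card {(a, b) \<in> square_pairs :: ('a \<times> 'a) set. a \<noteq> b} + card (conic (1::'a))" .
  obtain m where m: "card {(a, b) \<in> square_pairs :: ('a \<times> 'a) set. a \<noteq> b} = 2 * m"
    using even_card_square_pairs_off_diagonal[where 'a = 'a] by (rule evenE)
  \<comment> \<open>The first summand is \<open>16 * m\<close>, so only the circle, with
    \<open>CARD('a) - 3\<close> points, decides.\<close>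
  have "evenperm (induced_perm ?s) \<longleftrightarrow> 16 dvd card (conic (1::'a))"
    unfolding even m by (simp add: dvd_add_right_iff)
  also have "\<dots> \<longleftrightarrow> CARD('a) mod 16 = 3"
    unfolding ns(3)[symmetric] by presburger
  finally show ?thesis .
qed

section \<open>The group\<close>

lemma evenperm_induced_comp:
  fixes f g :: "'a::{comm_ring_1, finite} point \<Rightarrow> 'a point"
  assumes "induced_perm f permutes Y_set" "induced_perm g permutes Y_set"
  shows "evenperm (induced_perm (f \<circ> g)) \<longleftrightarrow> (evenperm (induced_perm f) \<longleftrightarrow> evenperm (induced_perm g))"
proof -
  have "induced_perm g B \<in> Y_set" if "B \<in> Y_set" for B
    using assms(2) that by (simp add: permutes_in_image)
  then have "induced_perm (f \<circ> g) = induced_perm f \<circ> induced_perm g"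
    by (auto simp: induced_perm_def image_comp fun_eq_iff)
  moreover have "permutation (induced_perm f)" "permutation (induced_perm g)"
    using assms by (auto intro: permutes_imp_permutation[OF finite])
  ultimately show ?thesis
    by (simp add: evenperm_comp)
qed

text \<open>The sign is multiplicative, so conjugate generators share it; only one move and one
  transposition remain to be tested.\<close>

lemma H_gens_even_iff:
  "(\<forall>\<sigma> \<in> (H_gens :: ('a::{comm_ring_1, finite} point set \<Rightarrow> 'a point set) set). evenperm \<sigma>) \<longleftrightarrow>
    evenperm (induced_perm (m3 :: 'a point \<Rightarrow> 'a point)) \<and>
    evenperm (induced_perm (\<lambda>(x, y, z). (y, x, z) :: 'a point))"
proof -
  let ?i = "\<lambda>(x, y, z). (x, y, z) :: 'a point" and ?a = "\<lambda>(x, y, z). (x, z, y) :: 'a point"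
    and ?b = "\<lambda>(x, y, z). (y, x, z) :: 'a point" and ?c = "\<lambda>(x, y, z). (y, z, x) :: 'a point"
    and ?d = "\<lambda>(x, y, z). (z, x, y) :: 'a point" and ?e = "\<lambda>(x, y, z). (z, y, x) :: 'a point"
  define E :: "('a point \<Rightarrow> 'a point) \<Rightarrow> bool" where "E f = evenperm (induced_perm f)" for f
  define R :: "('a point \<Rightarrow> 'a point) \<Rightarrow> bool" where "R f \<longleftrightarrow> induced_perm f permutes Y_set" for f
  have comp: "E (f \<circ> g) \<longleftrightarrow> (E f \<longleftrightarrow> E g)" if "R f" "R g" for f g
    using evenperm_induced_comp that by (simp add: E_def R_def)
  have R: "R ?i" "R ?a" "R ?b" "R ?c" "R ?d" "R ?e" "R m1" "R m2" "R m3"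
    unfolding R_def using induced_m_permutes
    by (auto intro!: induced_coordinate_perm_permutes simp: coordinate_perms_def)
  \<comment> \<open>The first three equations write the identity and both 3-cycles as squares, hence
    even; the others express conjugacies.\<close>
  have eqs: "?i \<circ> ?i = ?i" "?c \<circ> ?c = ?d" "?d \<circ> ?d = ?c" "?b \<circ> ?d = ?d \<circ> ?e" "?b \<circ> ?c = ?c \<circ> ?a"
    "?e \<circ> m1 = m3 \<circ> ?e" "?a \<circ> m2 = m3 \<circ> ?a"
    by (auto simp: fun_eq_iff m1_def m2_def m3_def mult.commute)
  have "E ?i" "E ?c = E ?d" "E ?d" "E ?a = E ?b" "E ?e = E ?b" "E m1 = E m3" "E m2 = E m3"
    using R eqs comp by metis+
  then show ?thesis
    by (auto simp: H_gens_def coordinate_perms_def E_def)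
qed

lemma subgroup_Alt_on:
  assumes "finite S"
  shows "subgroup (carrier (Alt_on S)) (Sym_on S)"
proof (rule group.subgroupI[OF group_Sym_on])
  have perm: "permutation \<sigma>" if "\<sigma> permutes S" for \<sigma>
    using assms that by (rule permutes_imp_permutation)
  show "carrier (Alt_on S) \<subseteq> carrier (Sym_on S)"
    by (auto simp: Alt_on_def Sym_on_def)
  show "carrier (Alt_on S) \<noteq> {}"
    by (auto simp: Alt_on_def intro!: exI[of _ id] permutes_id)
  fix \<sigma> assume \<sigma>: "\<sigma> \<in> carrier (Alt_on S)"
  have "inv\<^bsub>Sym_on S\<^esub> \<sigma> = inv_into UNIV \<sigma>"
    using \<sigma> by (intro group.inv_equality[OF group_Sym_on])
      (auto simp: Alt_on_def Sym_on_def permutes_inv_o intro: permutes_inv)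
  then show "inv\<^bsub>Sym_on S\<^esub> \<sigma> \<in> carrier (Alt_on S)"
    using \<sigma> perm by (auto simp: Alt_on_def evenperm_inv intro: permutes_inv)
  fix \<tau> assume "\<tau> \<in> carrier (Alt_on S)"
  then show "\<sigma> \<otimes>\<^bsub>Sym_on S\<^esub> \<tau> \<in> carrier (Alt_on S)"
    using \<sigma> perm by (auto simp: Alt_on_def Sym_on_def evenperm_comp intro: permutes_compose)
qed

lemma H_group_subgroup_Alt_on_iff:
  "subgroup (H_group :: ('a::{comm_ring_1, finite} point set \<Rightarrow> 'a point set) set) (Alt_on Y_set)
    \<longleftrightarrow> (\<forall>\<sigma> \<in> (H_gens :: ('a point set \<Rightarrow> 'a point set) set). evenperm \<sigma>)"
proof
  assume "subgroup (H_group :: ('a point set \<Rightarrow> 'a point set) set) (Alt_on Y_set)"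
  then have "H_group \<subseteq> carrier (Alt_on (Y_set :: 'a point set set))"
    by (rule subgroup.subset)
  moreover have "\<sigma> \<in> H_group" if "\<sigma> \<in> H_gens" for \<sigma> :: "'a point set \<Rightarrow> 'a point set"
    using that unfolding H_group_def by (rule generate.incl)
  ultimately show "\<forall>\<sigma> \<in> (H_gens :: ('a point set \<Rightarrow> 'a point set) set). evenperm \<sigma>"
    by (auto simp: Alt_on_def)
next
  assume even: "\<forall>\<sigma> \<in> (H_gens :: ('a point set \<Rightarrow> 'a point set) set). evenperm \<sigma>"
  let ?Y = "Y_set :: 'a point set set"
  have Alt: "subgroup (carrier (Alt_on ?Y)) (Sym_on ?Y)"
    by (rule subgroup_Alt_on) simp
  have "H_gens \<subseteq> carrier (Alt_on ?Y)"
    using even H_gens_subset by (auto simp: Alt_on_def Sym_on_def)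
  then have "H_group \<subseteq> carrier (Alt_on ?Y)"
    unfolding H_group_def using Alt by (rule group.generate_subgroup_incl[OF group_Sym_on])
  \<comment> \<open>\<open>Alt_on ?Y\<close> is \<open>Sym_on ?Y\<close> with its carrier
    restricted, so inclusion of carriers suffices.\<close>
  then have "subgroup H_group (Sym_on ?Y\<lparr>carrier := carrier (Alt_on ?Y)\<rparr>)"
    by (rule group.subgroup_incl[OF group_Sym_on H_group_subgroup Alt])
  then show "subgroup H_group (Alt_on ?Y)"
    by (simp add: Alt_on_def Sym_on_def)
qed

text \<open>Evenness of \<open>m3\<close> supplies exactly the congruence modulo 8 under which the
  sign of the swap is known.\<close>

lemma H_group_subgroup_Alt_on_iff_card:
  assumes two: "(2::'a::{field, finite}) \<noteq> 0"
  shows "subgroup (H_group :: ('a point set \<Rightarrow> 'a point set) set) (Alt_on Y_set) \<longleftrightarrow> CARD('a) mod 16 = 3"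
proof -
  have "CARD('a) mod 8 = 3" if "CARD('a) mod 16 = 3"
    using that by presburger
  then show ?thesis
    unfolding H_group_subgroup_Alt_on_iff H_gens_even_iff evenperm_induced_m3[OF two]
    using evenperm_induced_swap[OF two] by blast
qed

theorem theorem1p2:
  fixes p :: nat
  assumes "p = CARD('p::prime_card)"
    and "p > 3"
  shows "subgroup (H_group :: ('p mod_ring point set \<Rightarrow> 'p mod_ring point set) set) (Alt_on Y_set)
           \<longleftrightarrow> [p = 3] (mod 16)"
proof -
  have "(2 :: 'p mod_ring) \<noteq> 0"
  proof
    assume "(2 :: 'p mod_ring) = 0"
    then have "(of_nat 2 :: 'p mod_ring) = 0"
      by simp
    then have "CARD('p) dvd 2"
      by (simp add: of_nat_0_mod_ring_dvd)
    then show False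
      using assms by (auto dest: dvd_imp_le)
  qed
  then show ?thesis
    using H_group_subgroup_Alt_on_iff_card[where 'a = "'p mod_ring"] assms by (simp add: cong_def)
qed

end
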